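(* If $X_1,\dots,X_n$ are i.i.d. double exponential with zero mean, i.e. with density $\frac{\lambda}{2}e^{-\lambda|x|}$ for $-\infty<x<\infty$, then the probability $P^c_n(D)$ that the network on these $n$ nodes with cutoff range $r$ is connected is given by $$P^c_n(D)=\frac{1}{2^n}\sum_{\substack{k=0\\ k\ne n/2}}^{n}\binom{n}{k}\,P^c_k\,P^c_{n-k}\left(1+\frac{1}{n-2k}\left(k e^{-(n-k)\lambda r}-(n-k)e^{-k\lambda r}\right)\right)+\frac{(P^c_{n/2})^2}{2^n}\left(1-e^{-n\lambda r/2}\left(1+\frac{n\lambda r}{2}\right)\right),$$ where $P^c_0=1$ by definition, and the last term is present only when $n$ is even.
   Context: Here $\lambda>0$ and $r>0$. The network with cutoff range $r$ on a set of random points on the real line is the graph whose vertices are these points, with an edge between two distinct vertices if and only if the distance between them is at most $r$. For $m\ge 1$, $P^c_m$ denotes the probability that the network with cutoff range $r$ on $m$ i.i.d. exponential random variables with mean $\lambda^{-1}$ is connected.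
   Formalization: The printed formula is false (for n=1 it gives 0, not 1). The formal version replaces the factor in parentheses by 1 for k=0 and k=n, and multiplies the last term (k=n/2) by the missing binomial coefficient binom(n,n/2); n≥1 is assumed. *)

theory Defs
  imports "HOL-Probability.Probability" "Graph_Theory.Graph_Theory"
begin

(* Undirected edges are encoded, as usual in Graph_Theory, by arcs in both directions. *)
definition network :: "real \<Rightarrow> real set \<Rightarrow> real pair_pre_digraph" where
  "network r V = \<lparr> pverts = V, parcs = {(x, y). x \<in> V \<and> y \<in> V \<and> x \<noteq> y \<and> dist x y \<le> r} \<rparr>"

lemma pair_graph_network:
  assumes "finite V"
  shows "pair_graph (network r V)"
proof
  show "finite (parcs (network r V))"
    by (rule finite_subset[of _ "V \<times> V"]) (auto simp: network_def assms)
qed (auto simp: network_def assms symmetric_def dist_commute sym_def)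

(* The qualified name is needed: the topological notion is also called connected. *)
definition network_connected :: "real \<Rightarrow> real set \<Rightarrow> bool" where
  "network_connected r V \<longleftrightarrow> Digraph_Component.connected (with_proj (network r V))"

(* The law of m i.i.d. exponential variables with rate lam (mean 1/lam) is realised as a product
   measure. The value 1 at m = 0 is a convention, needed because the null graph does not
   count as connected in Graph_Theory. *)
definition exp_conn_prob :: "real \<Rightarrow> real \<Rightarrow> nat \<Rightarrow> real" where
  "exp_conn_prob lam r m = (if m = 0 then 1 else
     (let E = PiM {1..m} (\<lambda>_. density lborel (exponential_density lam))
      in measure E {x \<in> space E. network_connected r (x ` {1..m})}))"

end

theory Submission
  imports Defs
begin

text \<open>
  The network on a finite set of reals is connected exactly when no two consecutive points are
  more than \<open>r\<close> apart (\<open>network_connected_iff_gapless\<close>). This property survives reflection and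
  translation of the points, and for a set with points on both sides of \<open>0\<close> it splits into three
  conditions: the positive points are gapless, the reflected negative points are gapless, and the two
  points nearest to \<open>0\<close>, one on each side, are at most \<open>r\<close> apart (\<open>gapless_halves\<close>).

  Classify the \<open>n\<close> double exponential points by the set \<open>S\<close> of indices of the positive ones. Every such
  orthant has mass \<open>1 / 2 ^ n\<close>, and conditionally on it the absolute values are i.i.d. exponential
  (\<open>measure_gapless_laplace_orthant\<close>). So what is needed is the probability of the three conditions for
  two independent families of \<open>k\<close> and \<open>n - k\<close> exponential variables. By memorylessness, conditioning a
  family of \<open>k\<close> variables on all of them exceeding \<open>t\<close> only translates it by \<open>t\<close>; hence its minimum is
  exponential with rate \<open>k * lam\<close> and independent of the event that the family is gapless
  (\<open>distr_Min_gapless_exp\<close>). Fubini's theorem then factors the probability into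
  \<open>P\<^sub>k * P\<^sub>n\<^sub>-\<^sub>k\<close> times the probability that a sum of independent exponential variables with rates
  \<open>k * lam\<close> and \<open>(n - k) * lam\<close> is at most \<open>r\<close> (\<open>emeasure_two_clusters\<close>), which is an elementary
  integral whose closed form depends on whether the rates coincide, that is, on whether \<open>k = n / 2\<close>.
  If one side is empty there is no gap to bridge and this last factor is \<open>1\<close>. Summing over all \<open>S\<close>
  produces the binomial coefficients.

  Both changes of variables on product measures, the translation and the reflection of the negative
  coordinates, are instances of one coordinatewise principle, \<open>PiM_emeasure_restrict_map\<close>.
\<close>

section \<open>Connectedness of a network on the line\<close>

text \<open>
  Speaking of consecutive points by the absence of a point in between, rather than by an ordering or
  enumeration of \<open>V\<close>, makes the notion visibly invariant under reflection and, for the image of a finite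
  index set, a finite Boolean combination of inequalities, hence measurable. The empty set is gapless,
  which agrees with the convention \<open>P\<^sub>0 = 1\<close>.
\<close>

definition gapless :: "real \<Rightarrow> real set \<Rightarrow> bool" where
  "gapless r V \<longleftrightarrow> (\<forall>a\<in>V. \<forall>b\<in>V. r < b - a \<longrightarrow> (\<exists>c\<in>V. a < c \<and> c < b))"

text \<open>
  An edge is too short to jump across a gap, so everything reachable from a point left of a gap stays left
  of it. Conversely, without gaps two points are joined by recursively inserting a point between them
  until the distance is at most \<open>r\<close>; finiteness makes this stop.
\<close>

lemma network_connected_iff_gapless:
  assumes "finite V" "r \<ge> 0"
  shows "network_connected r V \<longleftrightarrow> V \<noteq> {} \<and> gapless r V"
proof -
  interpret pair_graph "network r V" by (rule pair_graph_network) fact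
  let ?G = "with_proj (network r V)"
  have arc: "(x, y) \<in> parcs (network r V) \<longleftrightarrow> x \<in> V \<and> y \<in> V \<and> x \<noteq> y \<and> dist x y \<le> r" for x y
    by (simp add: network_def)
  have verts: "verts ?G = V" by (simp add: network_def)
  have conn: "network_connected r V \<longleftrightarrow> V \<noteq> {} \<and> (\<forall>u\<in>V. \<forall>v\<in>V. u \<rightarrow>\<^sup>*\<^bsub>?G\<^esub> v)"
    unfolding network_connected_def Digraph_Component.connected_def strongly_connected_def
    using reachable_mk_symmetric_eq[OF sym_arcs] verts by simp
  \<comment> \<open>The points left of a gap \<open>(a, b)\<close> form a union of components.\<close>
  have cut: "x \<le> a"
    if "a \<rightarrow>\<^sup>*\<^bsub>?G\<^esub> x" and gap: "r < b - a" "\<And>c. c \<in> V \<Longrightarrow> c \<le> a \<or> b \<le> c" for a b x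
    using that(1)
  proof (induction rule: reachable_induct)
    case (step x y)
    then have "x \<in> V" "y \<in> V" "dist x y \<le> r" by (auto simp: arc)
    with step.IH gap(1) gap(2)[of y] show ?case by (auto simp: dist_real_def)
  qed simp
  have chain: "a \<rightarrow>\<^sup>*\<^bsub>?G\<^esub> b \<and> b \<rightarrow>\<^sup>*\<^bsub>?G\<^esub> a"
    if "gapless r V" "a \<in> V" "b \<in> V" "a \<le> b" for a b
    using that(2-)
  proof (induction "card {c \<in> V. a < c \<and> c < b}" arbitrary: a b rule: less_induct)
    case less
    show ?case
    proof (cases "b - a \<le> r")
      case True
      show ?thesis
      proof (cases "a = b")
        case True
        then show ?thesis using less.prems verts by (simp add: reachable_refl)
      next
        case False
        then have "(a, b) \<in> parcs (network r V)" "(b, a) \<in> parcs (network r V)"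
          using True less.prems by (auto simp: arc dist_real_def)
        then show ?thesis by (simp add: reachable_adjI)
      qed
    next
      case False
      then obtain c where c: "c \<in> V" "a < c" "c < b"
        using \<open>gapless r V\<close> less.prems unfolding gapless_def by (meson not_le)
      have "card {d \<in> V. a < d \<and> d < c} < card {d \<in> V. a < d \<and> d < b}"
        "card {d \<in> V. c < d \<and> d < b} < card {d \<in> V. a < d \<and> d < b}"
        using c \<open>finite V\<close> by (auto intro!: psubset_card_mono)
      with less.hyps[of a c] less.hyps[of c b] c less.prems show ?thesis
        by (meson less_imp_le reachable_trans)
    qed
  qed
  show ?thesis
  proof
    assume L: "network_connected r V"
    have "gapless r V"
      unfolding gapless_def
    proof (intro ballI impI, rule ccontr)
      fix a b assume ab: "a \<in> V" "b \<in> V" "r < b - a" "\<not> (\<exists>c\<in>V. a < c \<and> c < b)"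
      from L ab(1,2) have "a \<rightarrow>\<^sup>*\<^bsub>?G\<^esub> b" unfolding conn by blast
      then have "b \<le> a" by (rule cut[OF _ ab(3)]) (use ab(4) not_le in blast)
      with ab(3) \<open>r \<ge> 0\<close> show False by simp
    qed
    with L conn show "V \<noteq> {} \<and> gapless r V" by blast
  next
    assume "V \<noteq> {} \<and> gapless r V"
    then show "network_connected r V" unfolding conn using chain by (meson linear)
  qed
qed

lemma gapless_uminus: "gapless r (uminus ` V) \<longleftrightarrow> gapless r V"
proof -
  have "gapless r (uminus ` V)" if "gapless r V" for V
    unfolding gapless_def
  proof safe
    fix a b assume "a \<in> V" "b \<in> V" "r < - b - - a"
    with that obtain c where "c \<in> V" "b < c" "c < a" unfolding gapless_def by fastforce
    then show "\<exists>c\<in>uminus ` V. - a < c \<and> c < - b" by auto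
  qed
  from this[of V] this[of "uminus ` V"] show ?thesis by (auto simp: image_image)
qed

lemma gapless_translate: "gapless r ((\<lambda>x. x - t) ` V) \<longleftrightarrow> gapless r V"
  by (auto simp: gapless_def)

text \<open>
  Here \<open>B\<close> holds the absolute values of the negative points. The only pair of consecutive points on
  opposite sides of \<open>0\<close> is \<open>- Min B\<close> and \<open>Min A\<close>, at distance \<open>Min A + Min B\<close>.
\<close>

lemma gapless_halves:
  assumes "r > 0" "finite A" "finite B" "A \<noteq> {}" "B \<noteq> {}"
    and A: "\<And>x. x \<in> A \<Longrightarrow> 0 < x" and B: "\<And>x. x \<in> B \<Longrightarrow> 0 < x"
  shows "gapless r (A \<union> uminus ` B) \<longleftrightarrow> gapless r A \<and> gapless r B \<and> Min A + Min B \<le> r"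
proof
  assume U: "gapless r (A \<union> uminus ` B)"
  have 1: "gapless r A"
    unfolding gapless_def
  proof (intro ballI impI)
    fix a b assume ab: "a \<in> A" "b \<in> A" "r < b - a"
    with U obtain c where c: "c \<in> A \<union> uminus ` B" "a < c" "c < b" unfolding gapless_def by blast
    with A[OF ab(1)] B have "c \<in> A" by fastforce
    with c show "\<exists>c\<in>A. a < c \<and> c < b" by blast
  qed
  have 2: "gapless r (uminus ` B)"
    unfolding gapless_def
  proof (intro ballI impI)
    fix a b assume ab: "a \<in> uminus ` B" "b \<in> uminus ` B" "r < b - a"
    with U obtain c where c: "c \<in> A \<union> uminus ` B" "a < c" "c < b" unfolding gapless_def by blast
    with ab B A[of c] have "c \<in> uminus ` B" by fastforce
    with c show "\<exists>c\<in>uminus ` B. a < c \<and> c < b" by blast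
  qed
  have 3: "Min A + Min B \<le> r"
  proof (rule ccontr)
    assume "\<not> ?thesis"
    then have "r < Min A - (- Min B)" by simp
    moreover have "Min A \<in> A \<union> uminus ` B" "- Min B \<in> A \<union> uminus ` B" using assms by auto
    ultimately obtain c where c: "c \<in> A \<union> uminus ` B" "- Min B < c" "c < Min A"
      using U unfolding gapless_def by blast
    then show False using Min_le[OF \<open>finite A\<close>, of c] Min_le[OF \<open>finite B\<close>, of "- c"] by auto
  qed
  from 1 2 3 show "gapless r A \<and> gapless r B \<and> Min A + Min B \<le> r"
    by (simp add: gapless_uminus)
next
  assume *: "gapless r A \<and> gapless r B \<and> Min A + Min B \<le> r"
  then have gB: "gapless r (uminus ` B)" by (simp add: gapless_uminus)
  have mA: "Min A \<in> A" "\<And>x. x \<in> A \<Longrightarrow> Min A \<le> x" and mB: "Min B \<in> B" "\<And>x. x \<in> B \<Longrightarrow> Min B \<le> x"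
    using assms by auto
  show "gapless r (A \<union> uminus ` B)"
    unfolding gapless_def
  proof (intro ballI impI)
    fix a b assume ab: "a \<in> A \<union> uminus ` B" "b \<in> A \<union> uminus ` B" "r < b - a"
    consider "a \<in> A" "b \<in> A" | "a \<in> uminus ` B" "b \<in> uminus ` B"
      | "a \<in> A" "b \<in> uminus ` B" | "a \<in> uminus ` B" "b \<in> A" using ab by blast
    then show "\<exists>c\<in>A \<union> uminus ` B. a < c \<and> c < b"
    proof cases
      case 1 then show ?thesis using * ab(3) unfolding gapless_def by blast
    next
      case 2 then show ?thesis using gB ab(3) unfolding gapless_def by blast
    next
      case 3 then show ?thesis using A B ab(3) \<open>r > 0\<close> by fastforce
    next
      case 4
      then obtain b' where b': "b' \<in> B" "a = - b'" by auto
      show ?thesis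
      proof (cases "a < - Min B")
        case True
        then show ?thesis using mB(1) B[OF mB(1)] A[OF 4(2)] by (intro bexI[of _ "- Min B"]) auto
      next
        case False
        then have "a = - Min B" using mB(2)[OF b'(1)] b' by simp
        then have "Min A < b" using * ab(3) by auto
        then show ?thesis using mA(1) A[OF mA(1)] B[OF b'(1)] b'(2)
          by (intro bexI[of _ "Min A"]) auto
      qed
    qed
  qed
qed

section \<open>Coordinatewise change of variables in a product measure\<close>

text \<open>
  If each \<open>M i\<close> is, up to the factor \<open>c i\<close>, the image under \<open>g i\<close> of the restriction of \<open>N i\<close> to \<open>B i\<close>, then
  the same relation holds between the products. Both sides are measures in \<open>C\<close>, so it is enough to
  compare them on boxes.
\<close>

lemma PiM_emeasure_restrict_map:
  assumes I: "finite I" and M: "\<And>i. prob_space (M i)" and N: "\<And>i. prob_space (N i)"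
    and g [measurable]: "\<And>i. i \<in> I \<Longrightarrow> g i \<in> measurable (N i) (M i)"
    and B: "\<And>i. i \<in> I \<Longrightarrow> B i \<in> sets (N i)"
    and eq: "\<And>i A. i \<in> I \<Longrightarrow> A \<in> sets (M i) \<Longrightarrow>
      emeasure (M i) A = c i * emeasure (N i) {x \<in> B i. g i x \<in> A}"
    and C: "C \<in> sets (PiM I M)"
  shows "emeasure (PiM I M) C = (\<Prod>i\<in>I. c i) * emeasure (PiM I N) {x \<in> PiE I B. (\<lambda>i\<in>I. g i (x i)) \<in> C}"
proof -
  interpret M: product_sigma_finite M
    by standard (rule sigma_finite_measure.sigma_finite_countable[OF prob_space_imp_sigma_finite[OF M]])
  interpret N: product_sigma_finite N
    by standard (rule sigma_finite_measure.sigma_finite_countable[OF prob_space_imp_sigma_finite[OF N]])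
  let ?G = "\<lambda>x. \<lambda>i\<in>I. g i (x i)"
  have G [measurable]: "?G \<in> measurable (PiM I N) (PiM I M)"
    using g by measurable
  have PB [measurable]: "PiE I B \<in> sets (PiM I N)"
    using I B by (rule sets_PiM_I_finite)
  let ?P = "distr (density (PiM I N) (\<lambda>x. (\<Prod>i\<in>I. c i) * indicator (PiE I B) x)) (PiM I M) ?G"
  have P: "emeasure ?P C = (\<Prod>i\<in>I. c i) * emeasure (PiM I N) {x \<in> PiE I B. ?G x \<in> C}"
    if [measurable]: "C \<in> sets (PiM I M)" for C
  proof -
    have [measurable]: "?G -` C \<inter> space (PiM I N) \<in> sets (PiM I N)" by measurable
    have S: "{x \<in> PiE I B. ?G x \<in> C} = PiE I B \<inter> (?G -` C \<inter> space (PiM I N))"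
      using sets.sets_into_space[OF PB] by auto
    have "emeasure ?P C = emeasure (density (PiM I N) (\<lambda>x. (\<Prod>i\<in>I. c i) * indicator (PiE I B) x))
        (?G -` C \<inter> space (PiM I N))"
      by (subst emeasure_distr) auto
    also have "\<dots> = (\<integral>\<^sup>+x. (\<Prod>i\<in>I. c i) * indicator {x \<in> PiE I B. ?G x \<in> C} x \<partial>PiM I N)"
      unfolding S by (subst emeasure_density) (auto intro!: nn_integral_cong split: split_indicator)
    also have "\<dots> = (\<Prod>i\<in>I. c i) * emeasure (PiM I N) {x \<in> PiE I B. ?G x \<in> C}"
      unfolding S by (rule nn_integral_cmult_indicator) measurable
    finally show ?thesis .
  qed
  have "?P = PiM I M"
  proof (rule M.PiM_eqI[OF I])
    fix A assume A: "\<And>i. i \<in> I \<Longrightarrow> A i \<in> sets (M i)"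
    have box: "{x \<in> PiE I B. ?G x \<in> PiE I A} = PiE I (\<lambda>i. {x \<in> B i. g i x \<in> A i})"
      by (auto simp: PiE_iff extensional_def)
    have "{x \<in> B i. g i x \<in> A i} \<in> sets (N i)" if "i \<in> I" for i
    proof -
      have "{x \<in> B i. g i x \<in> A i} = B i \<inter> (g i -` A i \<inter> space (N i))"
        using sets.sets_into_space[OF B[OF that]] by auto
      then show ?thesis using B[OF that] measurable_sets[OF g[OF that] A[OF that]] by simp
    qed
    then have "emeasure ?P (PiE I A) = (\<Prod>i\<in>I. c i) * (\<Prod>i\<in>I. emeasure (N i) {x \<in> B i. g i x \<in> A i})"
      using A I by (simp only: P box N.emeasure_PiM sets_PiM_I_finite)
    also have "\<dots> = (\<Prod>i\<in>I. emeasure (M i) (A i))"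
      using eq A by (simp add: prod.distrib[symmetric])
    finally show "emeasure ?P (PiE I A) = (\<Prod>i\<in>I. emeasure (M i) (A i))" .
  qed simp
  with P[OF C] show ?thesis by simp
qed

section \<open>The exponential and the double exponential law\<close>

abbreviation exp_law :: "real \<Rightarrow> real measure" where
  "exp_law lam \<equiv> density lborel (exponential_density lam)"

abbreviation laplace_law :: "real \<Rightarrow> real measure" where
  "laplace_law lam \<equiv> density lborel (\<lambda>x. lam / 2 * exp (- lam * \<bar>x\<bar>))"

lemma pred_gapless [measurable (raw)]:
  assumes [measurable]: "finite I" "\<And>i. i \<in> I \<Longrightarrow> f i \<in> borel_measurable M"
  shows "Measurable.pred M (\<lambda>w. gapless r ((\<lambda>i. f i w) ` I))"
proof -
  have "gapless r ((\<lambda>i. f i w) ` I) \<longleftrightarrow>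
    (\<forall>i\<in>I. \<forall>j\<in>I. r < f j w - f i w \<longrightarrow> (\<exists>k\<in>I. f i w < f k w \<and> f k w < f j w))" for w
    by (auto simp: gapless_def)
  then show ?thesis by simp
qed

lemma AE_exp_law_pos: "AE x in exp_law lam. 0 < x"
  using AE_lborel_singleton[of 0]
  by (auto simp: AE_density exponential_density_def)

text \<open>
  Memorylessness, in the form asked for by \<open>PiM_emeasure_restrict_map\<close>: above \<open>t\<close> the law looks like its
  own translate, with mass \<open>exp (- lam * t)\<close>.
\<close>

lemma exp_law_memoryless:
  assumes "t \<ge> 0" and A [measurable]: "A \<in> sets borel"
  shows "emeasure (exp_law lam) A =
    ennreal (exp (lam * t)) * emeasure (exp_law lam) {x \<in> {t<..}. x - t \<in> A}"
proof -
  have [measurable]: "{x \<in> {t<..}. x - t \<in> A} \<in> sets borel" by measurable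
  have "ennreal (exp (lam * t)) * emeasure (exp_law lam) {x \<in> {t<..}. x - t \<in> A} =
     (\<integral>\<^sup>+x. ennreal (exp (lam * t)) * (ennreal (exponential_density lam x) * indicator {x \<in> {t<..}. x - t \<in> A} x) \<partial>lborel)"
    by (subst emeasure_density) (auto intro!: nn_integral_cmult[symmetric])
  also have "\<dots> = (\<integral>\<^sup>+x. ennreal (exp (lam * t)) * (ennreal (exponential_density lam (t + 1 * x)) *
      indicator {x \<in> {t<..}. x - t \<in> A} (t + 1 * x)) \<partial>lborel)"
    by (subst nn_integral_real_affine[where c = 1 and t = t]) auto
  also have "\<dots> = (\<integral>\<^sup>+x. ennreal (exponential_density lam x) * indicator A x \<partial>lborel)"
  proof (rule nn_integral_cong_AE)
    show "AE x in lborel. ennreal (exp (lam * t)) * (ennreal (exponential_density lam (t + 1 * x)) *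
      indicator {x \<in> {t<..}. x - t \<in> A} (t + 1 * x)) = ennreal (exponential_density lam x) * indicator A x"
      using AE_lborel_singleton[of 0]
    proof eventually_elim
      case (elim x)
      have "exp (lam * t) * (lam * exp (- (t + x) * lam)) = lam * exp (- x * lam)"
        by (simp add: exp_add[symmetric] algebra_simps)
      then have "ennreal (exp (lam * t)) * ennreal (lam * exp (- (t + x) * lam)) = ennreal (lam * exp (- x * lam))"
        by (simp only: ennreal_mult'[symmetric] exp_ge_zero)
      then show ?case using elim \<open>t \<ge> 0\<close>
        by (auto simp: exponential_density_def simp del: minus_add_distrib split: split_indicator)
    qed
  qed
  also have "\<dots> = emeasure (exp_law lam) A" by (simp add: emeasure_density)
  finally show ?thesis ..
qed

text \<open>
  Each half of the double exponential law is half an exponential law. Assigning the point \<open>0\<close> to the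
  negative side makes the two half-lines a partition, so that the orthants they span partition the whole
  product space.
\<close>

lemma exp_law_eq_half_laplace:
  assumes A [measurable]: "A \<in> sets borel"
  shows "emeasure (exp_law lam) A = 2 * emeasure (laplace_law lam) {x \<in> {0<..}. x \<in> A}"
    and "emeasure (exp_law lam) A = 2 * emeasure (laplace_law lam) {x \<in> {..0}. - x \<in> A}"
proof -
  let ?d = "\<lambda>x. ennreal (lam / 2 * exp (- lam * \<bar>x\<bar>))"
  have *: "emeasure (exp_law lam) A = 2 * emeasure (laplace_law lam) {x \<in> B. s * x \<in> A}"
    if [measurable]: "B \<in> sets borel" and s: "\<bar>s\<bar> = 1" "\<And>x. x \<noteq> 0 \<Longrightarrow> s * x \<in> B \<longleftrightarrow> x > 0" for B s
  proof -
    have [measurable]: "{x \<in> B. s * x \<in> A} \<in> sets borel" by measurable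
    have ss: "s * (s * x) = x" for x using s(1) by (cases "s \<ge> 0") auto
    have "2 * emeasure (laplace_law lam) {x \<in> B. s * x \<in> A} =
        (\<integral>\<^sup>+x. 2 * (?d x * indicator {x \<in> B. s * x \<in> A} x) \<partial>lborel)"
      by (subst emeasure_density) (auto intro!: nn_integral_cmult[symmetric])
    also have "\<dots> = (\<integral>\<^sup>+x. 2 * (?d (0 + s * x) * indicator {x \<in> B. s * x \<in> A} (0 + s * x)) \<partial>lborel)"
      using s(1) by (subst nn_integral_real_affine[where c = s and t = 0]) auto
    also have "\<dots> = (\<integral>\<^sup>+x. ennreal (exponential_density lam x) * indicator A x \<partial>lborel)"
    proof (rule nn_integral_cong_AE)
      show "AE x in lborel. 2 * (?d (0 + s * x) * indicator {x \<in> B. s * x \<in> A} (0 + s * x)) =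
        ennreal (exponential_density lam x) * indicator A x"
        using AE_lborel_singleton[of 0]
      proof eventually_elim
        case (elim x)
        have "2 * ennreal (lam / 2 * exp (- lam * \<bar>x\<bar>)) = ennreal (lam * exp (- lam * \<bar>x\<bar>))"
          by (subst ennreal_numeral[symmetric], subst ennreal_mult'[symmetric]) auto
        moreover have "indicator {x \<in> B. s * x \<in> A} (0 + s * x) = (indicator ({0<..} \<inter> A) x :: ennreal)"
          using elim s by (simp add: ss indicator_def)
        moreover have "\<bar>0 + s * x\<bar> = \<bar>x\<bar>" using s(1) by (simp add: abs_mult)
        ultimately show ?case using elim
          by (cases "x > 0") (auto simp: exponential_density_def mult.assoc[symmetric] mult.commute[of lam x] split: split_indicator)
      qed
    qed
    also have "\<dots> = emeasure (exp_law lam) A" by (simp add: emeasure_density)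
    finally show ?thesis ..
  qed
  show "emeasure (exp_law lam) A = 2 * emeasure (laplace_law lam) {x \<in> {0<..}. x \<in> A}"
    using *[of "{0<..}" 1] by simp
  show "emeasure (exp_law lam) A = 2 * emeasure (laplace_law lam) {x \<in> {..0}. - x \<in> A}"
    using *[of "{..0}" "-1"] by (simp add: less_le)
qed

lemma prob_space_laplace_law: "prob_space (laplace_law lam)" if "lam > 0"
proof
  interpret prob_space "exp_law lam" by (rule prob_space_exponential_density) fact
  have "2 * emeasure (laplace_law lam) (space (laplace_law lam)) =
    2 * emeasure (laplace_law lam) ({x \<in> {0<..}. x \<in> UNIV} \<union> {x \<in> {..0}. - x \<in> UNIV})"
    by (rule arg_cong[where f = "\<lambda>S. 2 * emeasure (laplace_law lam) S"]) auto
  also have "\<dots> = 2 * emeasure (laplace_law lam) {x \<in> {0<..}. x \<in> UNIV} + 2 * emeasure (laplace_law lam) {x \<in> {..0}. - x \<in> UNIV}"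
    by (subst plus_emeasure[symmetric]) (auto simp: distrib_left)
  also have "\<dots> = emeasure (exp_law lam) UNIV + emeasure (exp_law lam) UNIV"
    using exp_law_eq_half_laplace[of UNIV lam] by simp
  also have "\<dots> = 2 * 1" using emeasure_space_1 by simp
  finally show "emeasure (laplace_law lam) (space (laplace_law lam)) = 1"
    by (subst (asm) ennreal_mult_cancel_left) auto
qed

section \<open>Gapless families of exponential variables\<close>

text \<open>
  The variables being exchangeable, only the size of the index set matters; a bijection transfers the
  statement from the index set \<open>{1..card I}\<close>.
\<close>

lemma emeasure_gapless_exp:
  assumes "finite I" "lam > 0" "r > 0"
  shows "emeasure (PiM I (\<lambda>_. exp_law lam)) {x \<in> space (PiM I (\<lambda>_. exp_law lam)). gapless r (x ` I)} =
    ennreal (exp_conn_prob lam r (card I))"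
proof -
  let ?E = "\<lambda>I :: 'a set. PiM I (\<lambda>_. exp_law lam)"
  let ?F = "PiM {1..card I} (\<lambda>_. exp_law lam)"
  note P = prob_space_exponential_density[OF \<open>lam > 0\<close>]
  interpret F: prob_space ?F by (intro prob_space_PiM P)
  have conn: "ennreal (exp_conn_prob lam r (card I)) = emeasure ?F {x \<in> space ?F. gapless r (x ` {1..card I})}"
  proof (cases "card I = 0")
    case True
    then have "{x \<in> space ?F. gapless r (x ` {1..card I})} = space ?F" by (auto simp: gapless_def)
    then show ?thesis using True F.emeasure_space_1 by (simp add: exp_conn_prob_def)
  next
    case False
    then have "network_connected r (x ` {1..card I}) \<longleftrightarrow> gapless r (x ` {1..card I})" for x
      using \<open>r > 0\<close> by (subst network_connected_iff_gapless) auto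
    with False show ?thesis by (simp add: exp_conn_prob_def Let_def F.emeasure_eq_measure del: One_nat_def)
  qed
  obtain f where f: "bij_betw f {1..card I} I"
    using ex_bij_betw_nat_finite_1[OF \<open>finite I\<close>] by blast
  then have fI: "f ` {1..card I} = I" by (simp add: bij_betw_def)
  let ?t = "\<lambda>\<omega>. \<lambda>n\<in>{1..card I}. \<omega> (f n)"
  have t: "distr (?E I) ?F ?t = ?F"
    using f by (intro distr_PiM_reindex P) (auto simp: bij_betw_def)
  have [measurable]: "?t \<in> measurable (?E I) ?F"
    using fI by (intro measurable_restrict measurable_component_singleton) auto
  have "ennreal (exp_conn_prob lam r (card I)) =
      emeasure (distr (?E I) ?F ?t) {x \<in> space ?F. gapless r (x ` {1..card I})}"
    unfolding conn t ..
  also have "\<dots> = emeasure (?E I) (?t -` {x \<in> space ?F. gapless r (x ` {1..card I})} \<inter> space (?E I))"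
    by (rule emeasure_distr) measurable
  also have "?t -` {x \<in> space ?F. gapless r (x ` {1..card I})} \<inter> space (?E I) = {x \<in> space (?E I). gapless r (x ` I)}"
  proof -
    have "?t x ` {1..card I} = x ` f ` {1..card I}" for x :: "'a \<Rightarrow> real"
      by (auto simp: image_image)
    then have "?t x ` {1..card I} = x ` I" for x :: "'a \<Rightarrow> real"
      unfolding fI .
    moreover have "?t x \<in> space ?F" if "x \<in> space (?E I)" for x
      by (rule measurable_space[OF _ that]) measurable
    ultimately show ?thesis by auto
  qed
  finally show ?thesis ..
qed

text \<open>
  Translating by \<open>t\<close> maps the family conditioned to exceed \<open>t\<close> to an unconditioned family and does not
  change the gaps. This is the independence of the minimum and the spacings.
\<close>

lemma emeasure_gapless_exp_gt:
  assumes "finite I" "lam > 0" "r > 0" "t \<ge> 0"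
  shows "emeasure (PiM I (\<lambda>_. exp_law lam))
      {x \<in> space (PiM I (\<lambda>_. exp_law lam)). gapless r (x ` I) \<and> (\<forall>i\<in>I. t < x i)} =
    ennreal (exp_conn_prob lam r (card I) * exp (- (real (card I) * lam * t)))"
proof -
  let ?E = "PiM I (\<lambda>_. exp_law lam)"
  let ?G = "{x \<in> space ?E. gapless r (x ` I) \<and> (\<forall>i\<in>I. t < x i)}"
  note P = prob_space_exponential_density[OF \<open>lam > 0\<close>]
  have "emeasure ?E {x \<in> space ?E. gapless r (x ` I)} = (\<Prod>i\<in>I. ennreal (exp (lam * t))) *
     emeasure ?E {x \<in> PiE I (\<lambda>_. {t<..}). (\<lambda>i\<in>I. x i - t) \<in> {x \<in> space ?E. gapless r (x ` I)}}"
  proof (rule PiM_emeasure_restrict_map[where g = "\<lambda>_ x. x - t"])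
    show "{x \<in> space ?E. gapless r (x ` I)} \<in> sets ?E" using \<open>finite I\<close> by measurable
  next
    fix i :: 'a and A assume "A \<in> sets (exp_law lam)"
    then show "emeasure (exp_law lam) A =
        ennreal (exp (lam * t)) * emeasure (exp_law lam) {x \<in> {t<..}. x - t \<in> A}"
      by (intro exp_law_memoryless \<open>t \<ge> 0\<close>) simp
  qed (use \<open>finite I\<close> P in simp_all)
  also have "{x \<in> PiE I (\<lambda>_. {t<..}). (\<lambda>i\<in>I. x i - t) \<in> {x \<in> space ?E. gapless r (x ` I)}} = ?G"
  proof -
    have "(\<lambda>i\<in>I. x i - t) ` I = (\<lambda>x. x - t) ` x ` I" for x by (auto simp: image_image)
    then show ?thesis by (auto simp: gapless_translate space_PiM PiE_iff)
  qed
  also have "(\<Prod>i\<in>I. ennreal (exp (lam * t))) = ennreal (exp (real (card I) * lam * t))"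
    by (simp add: ennreal_power exp_of_nat_mult[symmetric] mult.assoc)
  finally have "ennreal (exp (- (real (card I) * lam * t))) * ennreal (exp_conn_prob lam r (card I)) =
    ennreal (exp (- (real (card I) * lam * t))) * ennreal (exp (real (card I) * lam * t)) * emeasure ?E ?G"
    using assms by (simp add: emeasure_gapless_exp mult.assoc)
  also have "ennreal (exp (- (real (card I) * lam * t))) * ennreal (exp (real (card I) * lam * t)) = 1"
    by (simp add: ennreal_mult'[symmetric] exp_add[symmetric])
  finally show ?thesis by (simp add: ennreal_mult'' mult.commute)
qed

lemma emeasure_exp_law_gt:
  assumes "lam > 0"
  shows "emeasure (exp_law lam) {t<..} = ennreal (if t \<ge> 0 then exp (- (lam * t)) else 1)"
proof -
  interpret prob_space "exp_law lam" by (rule prob_space_exponential_density) fact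
  have "emeasure (exp_law lam) {..t} = ennreal (erlang_CDF 0 lam t)"
    by (rule emeasure_erlang_density) fact
  then have "prob {..t} = erlang_CDF 0 lam t"
    using \<open>lam > 0\<close> by (simp add: emeasure_eq_measure erlang_CDF_0)
  moreover have "prob {t<..} = 1 - prob {..t}"
    using prob_compl[of "{..t}"] by (simp add: Compl_eq_Diff_UNIV[symmetric])
  ultimately show ?thesis by (simp add: emeasure_eq_measure erlang_CDF_0)
qed

text \<open>
  Restricted to the event that the family is gapless, the law of the minimum is still exponential with rate
  \<open>card I * lam\<close>, only its total mass is the probability of that event. Two finite measures that agree on all
  half-lines \<open>{t<..}\<close> are equal.
\<close>

lemma distr_Min_gapless_exp:
  assumes "finite I" "I \<noteq> {}" "lam > 0" "r > 0"
  defines "E \<equiv> PiM I (\<lambda>_. exp_law lam)"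
  shows "distr (density E (indicator {x \<in> space E. gapless r (x ` I)})) borel (\<lambda>x. Min (x ` I)) =
    density lborel (\<lambda>u. ennreal (exp_conn_prob lam r (card I)) * ennreal (exponential_density (real (card I) * lam) u))"
    (is "?L = ?R")
proof (rule measure_eqI_lessThan)
  interpret E: prob_space E unfolding E_def
    by (intro prob_space_PiM prob_space_exponential_density \<open>lam > 0\<close>)
  let ?p = "exp_conn_prob lam r (card I)"
  have [measurable]: "(\<lambda>x. x i) \<in> borel_measurable E" if "i \<in> I" for i
    unfolding E_def using that by measurable
  have [measurable]: "{x \<in> space E. gapless r (x ` I)} \<in> sets E"
    using \<open>finite I\<close> by measurable
  have [measurable]: "(\<lambda>x. Min (x ` I)) \<in> borel_measurable E"
    using \<open>finite I\<close> by measurable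
  have p: "emeasure E {x \<in> space E. gapless r (x ` I)} = ennreal ?p"
    unfolding E_def using assms by (intro emeasure_gapless_exp)
  have gt: "emeasure E {x \<in> space E. gapless r (x ` I) \<and> (\<forall>i\<in>I. t < x i)} =
      ennreal (?p * exp (- (real (card I) * lam * t)))" if "t \<ge> 0" for t
    unfolding E_def using assms that by (intro emeasure_gapless_exp_gt)
  have n: "real (card I) * lam > 0" using assms by (simp add: card_gt_0_iff)
  fix t :: real
  have L: "emeasure ?L {t<..} = emeasure E {x \<in> space E. gapless r (x ` I) \<and> (\<forall>i\<in>I. t < x i)}"
  proof -
    have "emeasure ?L {t<..} =
        emeasure (density E (indicator {x \<in> space E. gapless r (x ` I)})) ((\<lambda>x. Min (x ` I)) -` {t<..} \<inter> space E)"
      by (subst emeasure_distr) auto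
    also have "\<dots> = emeasure E ({x \<in> space E. gapless r (x ` I)} \<inter> ((\<lambda>x. Min (x ` I)) -` {t<..} \<inter> space E))"
      by (rule emeasure_restricted) measurable
    also have "{x \<in> space E. gapless r (x ` I)} \<inter> ((\<lambda>x. Min (x ` I)) -` {t<..} \<inter> space E) =
        {x \<in> space E. gapless r (x ` I) \<and> (\<forall>i\<in>I. t < x i)}"
    proof -
      have "t < Min (x ` I) \<longleftrightarrow> (\<forall>i\<in>I. t < x i)" for x :: "'a \<Rightarrow> real"
        using \<open>finite I\<close> \<open>I \<noteq> {}\<close> by (subst Min_gr_iff) auto
      then show ?thesis by auto
    qed
    finally show ?thesis .
  qed
  also have "\<dots> = ennreal (?p * (if t \<ge> 0 then exp (- (real (card I) * lam * t)) else 1))"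
  \<comment> \<open>For negative \<open>t\<close> the event lies between the one for \<open>t = 0\<close> and the one without a bound on the minimum, and these have equal probability.\<close>
  proof (cases "t \<ge> 0")
    case False
    have "ennreal ?p = emeasure E {x \<in> space E. gapless r (x ` I) \<and> (\<forall>i\<in>I. 0 < x i)}"
      using gt[of 0] by simp
    also have "\<dots> \<le> emeasure E {x \<in> space E. gapless r (x ` I) \<and> (\<forall>i\<in>I. t < x i)}"
      using False \<open>finite I\<close> by (intro emeasure_mono) fastforce+
    finally have "ennreal ?p \<le> emeasure E {x \<in> space E. gapless r (x ` I) \<and> (\<forall>i\<in>I. t < x i)}" .
    moreover have "emeasure E {x \<in> space E. gapless r (x ` I) \<and> (\<forall>i\<in>I. t < x i)} \<le> ennreal ?p"
      unfolding p[symmetric] by (intro emeasure_mono) auto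
    ultimately show ?thesis using False by simp
  qed (use gt in simp)
  also have "\<dots> = ennreal ?p * emeasure (exp_law (real (card I) * lam)) {t<..}"
    by (simp add: emeasure_exp_law_gt[OF n] ennreal_mult'')
  also have "\<dots> = emeasure ?R {t<..}"
    by (subst (1 2) emeasure_density) (auto simp: nn_integral_cmult[symmetric] mult.assoc)
  finally show "emeasure ?L {t<..} = emeasure ?R {t<..}" .
  show "emeasure ?L {t<..} < \<infinity>"
    unfolding L by (simp add: E.emeasure_eq_measure)
qed (auto simp: E_def)

section \<open>Two independent clusters\<close>

text \<open>
  The probability that a sum of two independent exponential variables with rates \<open>a\<close> and \<open>b\<close> is at most
  \<open>r\<close>: the distribution function of a hypoexponential law, which degenerates to an Erlang law for \<open>a = b\<close>.
\<close>

definition exp_sum_cdf :: "real \<Rightarrow> real \<Rightarrow> real \<Rightarrow> real" where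
  "exp_sum_cdf a b r = (if a = b then 1 - exp (- a * r) * (1 + a * r)
     else 1 + (b * exp (- a * r) - a * exp (- b * r)) / (a - b))"

text \<open>
  The integral conditions on the first summand \<open>u\<close>. Its integrand vanishes outside \<open>{0..r}\<close> and equals
  \<open>a * exp (- a * u) - a * exp (- b * r) * exp (- (a - b) * u)\<close> inside. For \<open>a = b\<close> the last term is a
  constant, which is why the antiderivative \<open>F\<close> needs a separate case.
\<close>

lemma
  assumes "a > 0" "b > 0" "r > 0"
  shows nn_integral_exp_sum_cdf: "(\<integral>\<^sup>+u. ennreal (exponential_density a u) * ennreal (erlang_CDF 0 b (r - u)) \<partial>lborel) =
      ennreal (exp_sum_cdf a b r)"
    and exp_sum_cdf_nonneg: "exp_sum_cdf a b r \<ge> 0"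
proof -
  define F where "F u = (if a = b then - exp (- a * u) - a * exp (- a * r) * u
    else a / (a - b) * exp (- b * r) * exp (- (a - b) * u) - exp (- a * u))" for u
  have deriv: "DERIV F u :> a * exp (- a * u) * (1 - exp (- b * (r - u)))" for u
  proof (cases "a = b")
    case True
    have "exp (- a * u) * exp (- a * (r - u)) = exp (- a * r)"
      by (simp add: exp_add[symmetric] algebra_simps)
    then show ?thesis using True unfolding F_def
      by (auto intro!: derivative_eq_intros simp: algebra_simps)
  next
    case False
    have "exp (- a * u) * exp (- b * (r - u)) = exp (- b * r) * exp (- (a - b) * u)"
      by (simp add: exp_add[symmetric] algebra_simps)
    then have E: "exp (- a * u) * (1 - exp (- b * (r - u))) = exp (- a * u) - exp (- b * r) * exp (- (a - b) * u)"
      by (simp add: right_diff_distrib)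
    define c where "c = a / (a - b)"
    have c: "c * (a - b) = a" using False by (simp add: c_def)
    have "DERIV F u :> c * exp (- b * r) * (exp (- (a - b) * u) * - (a - b)) - exp (- a * u) * - a"
      unfolding F_def c_def using False by (auto intro!: derivative_eq_intros)
    also have "c * exp (- b * r) * (exp (- (a - b) * u) * - (a - b)) - exp (- a * u) * - a =
        a * exp (- a * u) - c * (a - b) * (exp (- b * r) * exp (- (a - b) * u))"
      by (simp only: mult_minus_right mult_ac)
    also have "\<dots> = a * exp (- a * u) * (1 - exp (- b * (r - u)))"
      unfolding c mult.assoc E by (simp add: right_diff_distrib)
    finally show ?thesis .
  qed
  have nonneg: "0 \<le> a * exp (- a * u) * (1 - exp (- b * (r - u)))" if "u \<in> {0..r}" for u
    using that assms by (intro mult_nonneg_nonneg) auto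
  have cdf: "F r - F 0 = exp_sum_cdf a b r"
  proof (cases "a = b")
    case True
    then show ?thesis by (simp add: F_def exp_sum_cdf_def algebra_simps)
  next
    case False
    have "exp (- b * r) * exp (- (a - b) * r) = exp (- a * r)"
      by (simp add: exp_add[symmetric] algebra_simps)
    then have "F r - F 0 = a / (a - b) * exp (- a * r) - exp (- a * r) - (a / (a - b) * exp (- b * r) - 1)"
      using False by (simp add: F_def mult.assoc)
    also have "a / (a - b) * exp (- a * r) - exp (- a * r) = b / (a - b) * exp (- a * r)"
    proof -
      have "a / (a - b) - 1 = b / (a - b)" using False by (simp add: divide_diff_eq_iff)
      then show ?thesis by (metis left_diff_distrib mult_1)
    qed
    also have "b / (a - b) * exp (- a * r) - (a / (a - b) * exp (- b * r) - 1) = exp_sum_cdf a b r"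
      using False by (simp add: exp_sum_cdf_def diff_divide_distrib)
    finally show ?thesis .
  qed
  have "F 0 \<le> F r"
  proof (rule DERIV_nonneg_imp_nondecreasing[of 0 r F])
    show "\<exists>y. DERIV F u :> y \<and> 0 \<le> y" if "0 \<le> u" "u \<le> r" for u
      using deriv[of u] nonneg[of u] that atLeastAtMost_iff by blast
  qed (use assms in simp)
  with cdf show "exp_sum_cdf a b r \<ge> 0" by simp
  have "(\<integral>\<^sup>+u. ennreal (exponential_density a u) * ennreal (erlang_CDF 0 b (r - u)) \<partial>lborel) =
    (\<integral>\<^sup>+u. ennreal (a * exp (- a * u) * (1 - exp (- b * (r - u)))) * indicator {0..r} u \<partial>lborel)"
    using assms by (intro nn_integral_cong)
      (auto simp: exponential_density_def erlang_CDF_0 ennreal_mult'[symmetric] mult.commute split: split_indicator)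
  also have "\<dots> = ennreal (F r - F 0)"
    by (rule nn_integral_FTC_Icc[OF _ deriv nonneg]) (use assms in auto)
  finally show "(\<integral>\<^sup>+u. ennreal (exponential_density a u) * ennreal (erlang_CDF 0 b (r - u)) \<partial>lborel) =
      ennreal (exp_sum_cdf a b r)"
    unfolding cdf .
qed

text \<open>
  Fix the variables indexed by \<open>S\<close>. Those indexed by \<open>T\<close> enter only through being gapless and having
  a minimum of at most \<open>r - Min (x ` S)\<close>, so the inner integral is a function of \<open>Min (x ` S)\<close> alone, and
  the outer one can be computed from the law of that minimum.
\<close>

lemma emeasure_two_clusters:
  assumes ST: "finite S" "finite T" "S \<inter> T = {}" "S \<noteq> {}" "T \<noteq> {}" and "lam > 0" "r > 0"
  defines "E \<equiv> \<lambda>I. PiM I (\<lambda>_. exp_law lam)"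
  shows "emeasure (E (S \<union> T)) {x \<in> space (E (S \<union> T)). gapless r (x ` S) \<and> gapless r (x ` T) \<and>
      Min (x ` S) + Min (x ` T) \<le> r} =
    ennreal (exp_conn_prob lam r (card S) * exp_conn_prob lam r (card T) *
      exp_sum_cdf (real (card S) * lam) (real (card T) * lam) r)" (is "emeasure _ ?G = _")
proof -
  interpret product_sigma_finite "\<lambda>_. exp_law lam"
    by standard (rule sigma_finite_measure.sigma_finite_countable[OF
      prob_space_imp_sigma_finite[OF prob_space_exponential_density[OF \<open>lam > 0\<close>]]])
  let ?p = "exp_conn_prob lam r (card S)" and ?q = "exp_conn_prob lam r (card T)"
  let ?a = "real (card S) * lam" and ?b = "real (card T) * lam"
  have ab: "?a > 0" "?b > 0" using assms by (simp_all add: card_gt_0_iff)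
  have pq: "?p \<ge> 0" "?q \<ge> 0" by (simp_all add: exp_conn_prob_def Let_def)
  have comp [measurable]: "(\<lambda>x. x i) \<in> borel_measurable (E I)" if "i \<in> I" for i I
    unfolding E_def using that by measurable
  have G [measurable]: "?G \<in> sets (E (S \<union> T))" using ST by measurable
  have gapless_sets [measurable]: "{x \<in> space (E I). gapless r (x ` I)} \<in> sets (E I)" if "finite I" for I
    using that by measurable
  have Min_meas [measurable]: "(\<lambda>x. Min (x ` I)) \<in> borel_measurable (E I)" if "finite I" for I
    using that by measurable
  have [measurable]: "(\<lambda>u. ennreal (erlang_CDF 0 ?b (r - u))) \<in> borel_measurable borel"
    by (simp add: erlang_CDF_0)
  let ?I = "indicator {x \<in> space (E S). gapless r (x ` S)} :: _ \<Rightarrow> ennreal"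
  have inner: "emeasure (E T) {y \<in> space (E T). gapless r (y ` T) \<and> Min (y ` T) \<le> v} =
      ennreal ?q * ennreal (erlang_CDF 0 ?b v)" for v
  proof -
    let ?A = "{y \<in> space (E T). gapless r (y ` T)}" and ?m = "\<lambda>y. Min (y ` T)"
    note [measurable] = gapless_sets[OF ST(2)] Min_meas[OF ST(2)]
    have "emeasure (E T) {y \<in> space (E T). gapless r (y ` T) \<and> Min (y ` T) \<le> v} =
        emeasure (E T) (?A \<inter> (?m -` {..v} \<inter> space (E T)))"
      by (rule arg_cong2[where f = emeasure]) auto
    also have "\<dots> = emeasure (density (E T) (indicator ?A)) (?m -` {..v} \<inter> space (E T))"
      by (rule emeasure_restricted[symmetric]) measurable
    also have "\<dots> = emeasure (distr (density (E T) (indicator ?A)) borel ?m) {..v}"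
      by (subst emeasure_distr) auto
    also have "\<dots> = ennreal ?q * emeasure (exp_law ?b) {..v}"
      unfolding E_def distr_Min_gapless_exp[OF ST(2,5) \<open>lam > 0\<close> \<open>r > 0\<close>]
      by (subst (1 2) emeasure_density) (auto simp: nn_integral_cmult[symmetric] mult.assoc)
    finally show ?thesis using ab by (simp add: emeasure_erlang_density)
  qed
  have "emeasure (E (S \<union> T)) ?G = (\<integral>\<^sup>+x. indicator ?G x \<partial>E (S \<union> T))" by simp
  also have "\<dots> = (\<integral>\<^sup>+x. (\<integral>\<^sup>+y. indicator ?G (merge S T (x, y)) \<partial>E T) \<partial>E S)"
    unfolding E_def using ST G by (intro product_nn_integral_fold) (auto simp: E_def)
  also have "\<dots> = (\<integral>\<^sup>+x. ?I x * (ennreal ?q * ennreal (erlang_CDF 0 ?b (r - Min (x ` S)))) \<partial>E S)"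
  proof (intro nn_integral_cong)
    fix x assume x: "x \<in> space (E S)"
    have "(\<integral>\<^sup>+y. indicator ?G (merge S T (x, y)) \<partial>E T) =
      (\<integral>\<^sup>+y. ?I x * indicator {y \<in> space (E T). gapless r (y ` T) \<and> Min (y ` T) \<le> r - Min (x ` S)} y \<partial>E T)"
    proof (intro nn_integral_cong)
      fix y assume y: "y \<in> space (E T)"
      have "merge S T (x, y) ` S = x ` S" "merge S T (x, y) ` T = y ` T"
        using ST(3) by (auto simp: merge_def intro!: image_cong)
      moreover have "merge S T (x, y) \<in> space (E (S \<union> T))"
        using x y by (auto simp: E_def space_PiM PiE_iff)
      ultimately show "indicator ?G (merge S T (x, y)) =
        ?I x * indicator {y \<in> space (E T). gapless r (y ` T) \<and> Min (y ` T) \<le> r - Min (x ` S)} y"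
        using x y by (auto split: split_indicator)
    qed
    also have "\<dots> = ?I x * (ennreal ?q * ennreal (erlang_CDF 0 ?b (r - Min (x ` S))))"
      unfolding inner[symmetric] using ST by (intro nn_integral_cmult_indicator) measurable
    finally show "(\<integral>\<^sup>+y. indicator ?G (merge S T (x, y)) \<partial>E T) =
      ?I x * (ennreal ?q * ennreal (erlang_CDF 0 ?b (r - Min (x ` S))))" .
  qed
  also have "\<dots> = (\<integral>\<^sup>+x. ennreal ?q * ennreal (erlang_CDF 0 ?b (r - Min (x ` S))) \<partial>density (E S) ?I)"
    using ST by (subst nn_integral_density) (auto simp: erlang_CDF_0)
  also have "\<dots> = (\<integral>\<^sup>+u. ennreal ?q * ennreal (erlang_CDF 0 ?b (r - u)) \<partial>distr (density (E S) ?I) borel (\<lambda>x. Min (x ` S)))"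
    using ST by (subst nn_integral_distr) (auto simp: erlang_CDF_0)
  also have "\<dots> = (\<integral>\<^sup>+u. ennreal ?q * ennreal (erlang_CDF 0 ?b (r - u)) \<partial>
      density lborel (\<lambda>u. ennreal ?p * ennreal (exponential_density ?a u)))"
    unfolding E_def distr_Min_gapless_exp[OF ST(1,4) \<open>lam > 0\<close> \<open>r > 0\<close>] ..
  also have "\<dots> = (\<integral>\<^sup>+u. (ennreal ?p * ennreal ?q) *
      (ennreal (exponential_density ?a u) * ennreal (erlang_CDF 0 ?b (r - u))) \<partial>lborel)"
    by (subst nn_integral_density) (auto simp: erlang_CDF_0 mult_ac)
  also have "\<dots> = (ennreal ?p * ennreal ?q) * ennreal (exp_sum_cdf ?a ?b r)"
    using ab \<open>r > 0\<close> by (subst nn_integral_cmult) (auto simp: nn_integral_exp_sum_cdf)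
  also have "\<dots> = ennreal (?p * ?q * exp_sum_cdf ?a ?b r)"
    using pq by (simp add: ennreal_mult')
  finally show ?thesis .
qed

section \<open>Summation over the orthants\<close>

text \<open>
  The probability that the gap at \<open>0\<close> between \<open>k\<close> points on one side and \<open>m\<close> on the other is no obstacle.
\<close>

definition exp_gap_prob :: "real \<Rightarrow> real \<Rightarrow> nat \<Rightarrow> nat \<Rightarrow> real" where
  "exp_gap_prob lam r k m =
     (if k = 0 \<or> m = 0 then 1 else exp_sum_cdf (real k * lam) (real m * lam) r)"

lemma exp_gap_prob_nonneg: "lam > 0 \<Longrightarrow> r > 0 \<Longrightarrow> exp_gap_prob lam r k m \<ge> 0"
  by (simp add: exp_gap_prob_def exp_sum_cdf_nonneg)

lemma exp_conn_prob_nonneg: "exp_conn_prob lam r m \<ge> 0"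
  by (simp add: exp_conn_prob_def Let_def)

text \<open>
  Written as the image of one family over all of \<open>I\<close>, the signed point set falls under \<open>pred_gapless\<close>.
\<close>

lemma flip_image:
  fixes y :: "'i \<Rightarrow> real"
  assumes "S \<subseteq> I"
  shows "y ` S \<union> uminus ` y ` (I - S) = (\<lambda>i. if i \<in> S then y i else - y i) ` I"
  using assms by (auto simp: image_iff)

text \<open>
  The absolute values are positive only almost surely, so \<open>gapless_halves\<close> identifies the two events up to
  a null set. If all points lie on one side, one of the clusters is empty and the claim is about a
  single family.
\<close>

lemma emeasure_gapless_flip_exp:
  assumes I: "finite I" "S \<subseteq> I" and "lam > 0" "r > 0"
  defines "E \<equiv> PiM I (\<lambda>_. exp_law lam)"
  shows "emeasure E {y \<in> space E. gapless r (y ` S \<union> uminus ` y ` (I - S))} =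
    ennreal (exp_conn_prob lam r (card S) * exp_conn_prob lam r (card (I - S)) *
      exp_gap_prob lam r (card S) (card (I - S)))"
proof -
  have fin: "finite S" "finite (I - S)" using I by (auto intro: finite_subset)
  have I_eq: "S \<union> (I - S) = I" using I by auto
  consider "S = {}" | "I - S = {}" | "S \<noteq> {}" "I - S \<noteq> {}" by blast
  then show ?thesis
  proof cases
    case 1
    then show ?thesis using assms
      by (simp add: gapless_uminus exp_gap_prob_def emeasure_gapless_exp exp_conn_prob_def[of _ _ 0])
  next
    case 2
    with I have "S = I" by auto
    then show ?thesis using assms
      by (simp add: exp_gap_prob_def emeasure_gapless_exp exp_conn_prob_def[of _ _ 0])
  next
    case 3
    have AE_pos: "AE y in E. \<forall>i\<in>I. 0 < y i"
      unfolding E_def using I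
      by (intro AE_finite_allI AE_PiM_component prob_space_exponential_density \<open>lam > 0\<close> AE_exp_law_pos)
    have meas [measurable]: "(\<lambda>y. y i) \<in> borel_measurable E" if "i \<in> I" for i
      unfolding E_def using that by measurable
    have S_meas [measurable]: "(\<lambda>y. y i) \<in> borel_measurable E" if "i \<in> S" for i
      using that I(2) by (intro meas) auto
    have "emeasure E {y \<in> space E. gapless r (y ` S \<union> uminus ` y ` (I - S))} =
      emeasure E {y \<in> space E. gapless r (y ` S) \<and> gapless r (y ` (I - S)) \<and> Min (y ` S) + Min (y ` (I - S)) \<le> r}"
    proof (rule emeasure_eq_AE)
      show "AE y in E. y \<in> {y \<in> space E. gapless r (y ` S \<union> uminus ` y ` (I - S))} \<longleftrightarrow>
        y \<in> {y \<in> space E. gapless r (y ` S) \<and> gapless r (y ` (I - S)) \<and> Min (y ` S) + Min (y ` (I - S)) \<le> r}"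
        using AE_pos
      proof eventually_elim
        case (elim y)
        have "gapless r (y ` S \<union> uminus ` y ` (I - S)) \<longleftrightarrow>
          gapless r (y ` S) \<and> gapless r (y ` (I - S)) \<and> Min (y ` S) + Min (y ` (I - S)) \<le> r"
          using elim fin 3 I(2) \<open>r > 0\<close> by (intro gapless_halves) auto
        then show ?case by simp
      qed
      show "{y \<in> space E. gapless r (y ` S \<union> uminus ` y ` (I - S))} \<in> sets E"
        unfolding flip_image[OF I(2)] using I(1) by measurable
      show "{y \<in> space E. gapless r (y ` S) \<and> gapless r (y ` (I - S)) \<and> Min (y ` S) + Min (y ` (I - S)) \<le> r} \<in> sets E"
        using fin by measurable
    qed
    also have "\<dots> = ennreal (exp_conn_prob lam r (card S) * exp_conn_prob lam r (card (I - S)) *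
        exp_sum_cdf (real (card S) * lam) (real (card (I - S)) * lam) r)"
      using emeasure_two_clusters[OF fin Diff_disjoint 3 \<open>lam > 0\<close> \<open>r > 0\<close>] unfolding I_eq E_def .
    finally show ?thesis using 3 fin by (simp add: exp_gap_prob_def)
  qed
qed

text \<open>
  Reflecting the coordinates outside \<open>S\<close> maps this orthant to the positive one, where the double
  exponential product law is \<open>1 / 2 ^ card I\<close> times the exponential one.
\<close>

lemma measure_gapless_laplace_orthant:
  assumes I: "finite I" "S \<subseteq> I" and "lam > 0" "r > 0"
  defines "L \<equiv> PiM I (\<lambda>_. laplace_law lam)"
  shows "measure L {x \<in> space L. gapless r (x ` I) \<and> (\<forall>i\<in>I. 0 < x i \<longleftrightarrow> i \<in> S)} =
    exp_conn_prob lam r (card S) * exp_conn_prob lam r (card (I - S)) *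
      exp_gap_prob lam r (card S) (card (I - S)) / 2 ^ card I"
proof -
  let ?E = "PiM I (\<lambda>_. exp_law lam)"
  let ?O = "{x \<in> space L. gapless r (x ` I) \<and> (\<forall>i\<in>I. 0 < x i \<longleftrightarrow> i \<in> S)}"
  let ?C = "{y \<in> space ?E. gapless r (y ` S \<union> uminus ` y ` (I - S))}"
  let ?B = "\<lambda>i. if i \<in> S then {0<..} else {..0::real}"
  let ?s = "\<lambda>i x. if i \<in> S then x else - x :: real"
  note P = prob_space_exponential_density[OF \<open>lam > 0\<close>] prob_space_laplace_law[OF \<open>lam > 0\<close>]
  interpret L: prob_space L unfolding L_def by (intro prob_space_PiM P)
  have "emeasure ?E ?C = (\<Prod>i\<in>I. 2) * emeasure L {x \<in> PiE I ?B. (\<lambda>i\<in>I. ?s i (x i)) \<in> ?C}"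
    unfolding L_def
  proof (rule PiM_emeasure_restrict_map)
    show "?C \<in> sets ?E" unfolding flip_image[OF I(2)] using I(1) by measurable
    show "emeasure (exp_law lam) A = 2 * emeasure (laplace_law lam) {x \<in> ?B i. ?s i x \<in> A}"
      if "A \<in> sets (exp_law lam)" for i A
      using that exp_law_eq_half_laplace[of A lam] by (cases "i \<in> S") simp_all
  qed (use I(1) P in simp_all)
  also have "{x \<in> PiE I ?B. (\<lambda>i\<in>I. ?s i (x i)) \<in> ?C} = ?O"
  proof -
    have "(\<lambda>i. ?s i ((\<lambda>i\<in>I. ?s i (x i)) i)) ` I = x ` I" for x :: "'a \<Rightarrow> real" by (auto intro!: image_cong)
    then show ?thesis unfolding flip_image[OF I(2)]
      by (auto simp: L_def space_PiM PiE_iff split: if_splits)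
  qed
  also have "(\<Prod>i\<in>I. 2) * emeasure L ?O = ennreal (2 ^ card I * measure L ?O)"
    by (simp add: L.emeasure_eq_measure ennreal_mult' ennreal_power[symmetric])
  finally have "ennreal (2 ^ card I * measure L ?O) = emeasure ?E ?C" ..
  also have "\<dots> = ennreal (exp_conn_prob lam r (card S) * exp_conn_prob lam r (card (I - S)) *
      exp_gap_prob lam r (card S) (card (I - S)))"
    by (rule emeasure_gapless_flip_exp) fact+
  finally have "2 ^ card I * measure L ?O = exp_conn_prob lam r (card S) * exp_conn_prob lam r (card (I - S)) *
      exp_gap_prob lam r (card S) (card (I - S))"
    using assms(3,4) by (subst (asm) ennreal_inj) (auto simp: exp_gap_prob_nonneg exp_conn_prob_nonneg)
  then show ?thesis by (simp add: field_simps)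
qed

lemma sum_Pow_card:
  fixes f :: "nat \<Rightarrow> real"
  assumes "finite I"
  shows "(\<Sum>S\<in>Pow I. f (card S)) = (\<Sum>k\<in>{0..card I}. real (card I choose k) * f k)"
proof -
  have "(\<Sum>S\<in>Pow I. f (card S)) = (\<Sum>k\<in>{0..card I}. \<Sum>S\<in>{S \<in> Pow I. card S = k}. f (card S))"
    using assms by (intro sum.group[symmetric]) (auto intro: card_mono)
  also have "\<dots> = (\<Sum>k\<in>{0..card I}. \<Sum>S\<in>{S. S \<subseteq> I \<and> card S = k}. f k)"
    by (intro sum.cong) auto
  finally show ?thesis using assms by (simp add: n_subsets)
qed

lemma measure_gapless_laplace:
  assumes I: "finite I" and "lam > 0" "r > 0"
  defines "L \<equiv> PiM I (\<lambda>_. laplace_law lam)" and "n \<equiv> card I"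
  shows "measure L {x \<in> space L. gapless r (x ` I)} = (\<Sum>k\<in>{0..n}. real (n choose k) *
    (exp_conn_prob lam r k * exp_conn_prob lam r (n - k) * exp_gap_prob lam r k (n - k) / 2 ^ n))"
proof -
  interpret L: prob_space L unfolding L_def
    by (intro prob_space_PiM prob_space_laplace_law \<open>lam > 0\<close>)
  have [measurable]: "(\<lambda>x. x i) \<in> borel_measurable L" if "i \<in> I" for i
    unfolding L_def using that by measurable
  let ?O = "\<lambda>S. {x \<in> space L. gapless r (x ` I) \<and> (\<forall>i\<in>I. 0 < x i \<longleftrightarrow> i \<in> S)}"
  have "{x \<in> space L. gapless r (x ` I)} = (\<Union>S\<in>Pow I. ?O S)"
  proof -
    have "x \<in> (\<Union>S\<in>Pow I. ?O S)" if "x \<in> space L" "gapless r (x ` I)" for x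
      by (rule UN_I[of "{i \<in> I. 0 < x i}"]) (use that in auto)
    then show ?thesis by auto
  qed
  also have "measure L \<dots> = (\<Sum>S\<in>Pow I. measure L (?O S))"
  proof (rule L.finite_measure_finite_Union)
    show "?O ` Pow I \<subseteq> sets L" using I by auto
    show "disjoint_family_on ?O (Pow I)"
      unfolding disjoint_family_on_def
    proof (intro ballI impI)
      fix S T assume "S \<in> Pow I" "T \<in> Pow I" "S \<noteq> T"
      then obtain i where "i \<in> I" "(i \<in> S) \<noteq> (i \<in> T)" by blast
      then show "?O S \<inter> ?O T = {}" by auto
    qed
  qed (use I in simp)
  also have "\<dots> = (\<Sum>S\<in>Pow I. exp_conn_prob lam r (card S) * exp_conn_prob lam r (n - card S) *
      exp_gap_prob lam r (card S) (n - card S) / 2 ^ n)"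
    using measure_gapless_laplace_orthant[OF I _ \<open>lam > 0\<close> \<open>r > 0\<close>] I finite_subset[OF _ I]
    by (intro sum.cong) (auto simp: L_def n_def card_Diff_subset)
  also have "\<dots> = (\<Sum>k\<in>{0..n}. real (n choose k) *
    (exp_conn_prob lam r k * exp_conn_prob lam r (n - k) * exp_gap_prob lam r k (n - k) / 2 ^ n))"
    unfolding n_def by (rule sum_Pow_card[OF I])
  finally show ?thesis .
qed

text \<open>
  Both rates are multiples of \<open>lam\<close>, and the quotient in \<open>exp_sum_cdf\<close> is homogeneous of degree \<open>0\<close> in their
  prefactors, so \<open>lam\<close> survives only in the exponents.
\<close>

lemma exp_gap_prob_unequal:
  assumes "lam > 0" "k \<le> n" "real k \<noteq> real n / 2"
  shows "exp_gap_prob lam r k (n - k) = (if k = 0 \<or> k = n then 1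
       else 1 + 1 / (real n - 2 * real k) *
         (real k * exp (- (real n - real k) * lam * r) - (real n - real k) * exp (- real k * lam * r)))"
proof (cases "k = 0 \<or> k = n")
  case True
  then show ?thesis by (auto simp: exp_gap_prob_def)
next
  case False
  have nk: "real (n - k) = real n - real k" using assms by simp
  have ne: "real k * lam \<noteq> (real n - real k) * lam" using assms by auto
  have d: "(lam * x - lam * y) / (real k * lam - (real n - real k) * lam) = (y - x) / (real n - 2 * real k)" for x y
  proof -
    have "(lam * x - lam * y) / (real k * lam - (real n - real k) * lam) =
        (lam * (x - y)) / (lam * - (real n - 2 * real k))"
      by (simp add: algebra_simps)
    also have "\<dots> = (x - y) / - (real n - 2 * real k)" using assms(1) by simp
    also have "\<dots> = (y - x) / (real n - 2 * real k)" by (metis minus_diff_eq minus_divide_divide)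
    finally show ?thesis .
  qed
  have "exp_gap_prob lam r k (n - k) =
     1 + (lam * ((real n - real k) * exp (- (real k * lam) * r)) - lam * (real k * exp (- ((real n - real k) * lam) * r))) /
      (real k * lam - (real n - real k) * lam)"
    using False ne assms(2) by (auto simp: exp_gap_prob_def exp_sum_cdf_def nk mult_ac)
  also have "\<dots> = 1 + 1 / (real n - 2 * real k) *
         (real k * exp (- (real n - real k) * lam * r) - (real n - real k) * exp (- real k * lam * r))"
    unfolding d by (simp only: minus_mult_left[symmetric] times_divide_eq_left mult_1)
  finally show ?thesis using False by simp
qed

lemma exp_gap_prob_equal:
  assumes "even n" "n \<ge> 1"
  shows "exp_gap_prob lam r (n div 2) (n - n div 2) =
    1 - exp (- real n * lam * r / 2) * (1 + real n * lam * r / 2)"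
proof -
  from assms obtain m where "n = 2 * m" "m > 0" by (auto elim!: evenE)
  then show ?thesis by (simp add: exp_gap_prob_def exp_sum_cdf_def mult.assoc)
qed

(* Two slips in the printed formula are corrected here; without these corrections it is false
   for every n. The printed factor 1 + (...)/(n - 2k) is the probability that the gap between
   the k positive and the n - k negative points is at most r; it vanishes at k = 0 and k = n,
   where there is no gap and the factor has to be 1. The term for k = n/2 is printed without
   its coefficient n choose (n/2). *)
theorem mainTheorem2:
  fixes M :: "'a measure" and X :: "nat \<Rightarrow> 'a \<Rightarrow> real" and lam r :: real and n :: nat
  assumes "prob_space M" and "lam > 0" and "r > 0" and "n \<ge> 1"
    and "prob_space.indep_vars M (\<lambda>_. borel) X {1..n}"
    and "\<And>i. i \<in> {1..n} \<Longrightarrow> distributed M lborel (X i) (\<lambda>x. lam / 2 * exp (- lam * \<bar>x\<bar>))"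
  shows "measure M {\<omega> \<in> space M. network_connected r ((\<lambda>i. X i \<omega>) ` {1..n})} =
    1 / 2 ^ n * (\<Sum>k\<in>{k \<in> {0..n}. real k \<noteq> real n / 2}.
      real (n choose k) * exp_conn_prob lam r k * exp_conn_prob lam r (n - k) *
      (if k = 0 \<or> k = n then 1
       else 1 + 1 / (real n - 2 * real k) *
         (real k * exp (- (real n - real k) * lam * r) - (real n - real k) * exp (- real k * lam * r))))
    + (if even n
       then real (n choose (n div 2)) * (exp_conn_prob lam r (n div 2))\<^sup>2 / 2 ^ n *
         (1 - exp (- real n * lam * r / 2) * (1 + real n * lam * r / 2))
       else 0)"
proof -
  interpret prob_space M by fact
  let ?I = "{1..n}"
  let ?L = "PiM ?I (\<lambda>_. laplace_law lam)"
  let ?X = "\<lambda>\<omega>. \<lambda>i\<in>?I. X i \<omega>"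
  let ?F = "\<lambda>k. real (n choose k) *
    (exp_conn_prob lam r k * exp_conn_prob lam r (n - k) * exp_gap_prob lam r k (n - k) / 2 ^ n)"
  have rv [measurable]: "X i \<in> borel_measurable M" if "i \<in> ?I" for i
    using distributed_measurable[OF assms(6)[OF that]] by simp
  have "distr M (PiM ?I (\<lambda>_. borel)) ?X = PiM ?I (\<lambda>i. distr M borel (X i))"
    using indep_vars_iff_distr_eq_PiM'[where I = ?I and M' = "\<lambda>_. borel" and X = X] rv assms(4,5) by simp
  also have "\<dots> = ?L"
  proof (rule PiM_cong)
    fix i assume "i \<in> ?I"
    then have "distr M lborel (X i) = laplace_law lam"
      using assms(6) by (simp add: distributed_def)
    moreover have "distr M lborel (X i) = distr M borel (X i)" by (rule distr_cong) auto
    ultimately show "distr M borel (X i) = laplace_law lam" by simp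
  qed simp
  finally have X: "distr M (PiM ?I (\<lambda>_. borel)) ?X = ?L" .
  have ev [measurable]: "{x \<in> space (PiM ?I (\<lambda>_. borel)). gapless r (x ` ?I)} \<in> sets (PiM ?I (\<lambda>_. borel))"
    by measurable
  have space: "space ?L = space (PiM ?I (\<lambda>_. borel))" by (simp add: space_PiM)
  have "{\<omega> \<in> space M. network_connected r ((\<lambda>i. X i \<omega>) ` ?I)} =
      ?X -` {x \<in> space (PiM ?I (\<lambda>_. borel)). gapless r (x ` ?I)} \<inter> space M"
    using assms(3,4) by (auto simp: network_connected_iff_gapless space_PiM)
  then have "measure M {\<omega> \<in> space M. network_connected r ((\<lambda>i. X i \<omega>) ` ?I)} =
      measure ?L {x \<in> space ?L. gapless r (x ` ?I)}"
    unfolding space unfolding X[symmetric] by (subst measure_distr) (use rv in measurable)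
  also have "\<dots> = (\<Sum>k\<in>{0..n}. ?F k)"
    using measure_gapless_laplace[of ?I lam r] assms(2,3) by simp
  also have "\<dots> = (\<Sum>k\<in>{k \<in> {0..n}. real k \<noteq> real n / 2}. ?F k) + (\<Sum>k\<in>{k \<in> {0..n}. real k = real n / 2}. ?F k)"
    by (subst sum.union_disjoint[symmetric]) (auto intro!: sum.cong)
  also have "(\<Sum>k\<in>{k \<in> {0..n}. real k \<noteq> real n / 2}. ?F k) =
    1 / 2 ^ n * (\<Sum>k\<in>{k \<in> {0..n}. real k \<noteq> real n / 2}.
      real (n choose k) * exp_conn_prob lam r k * exp_conn_prob lam r (n - k) *
      (if k = 0 \<or> k = n then 1
       else 1 + 1 / (real n - 2 * real k) *
         (real k * exp (- (real n - real k) * lam * r) - (real n - real k) * exp (- real k * lam * r))))"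
    unfolding sum_distrib_left
    by (rule sum.cong[OF refl], subst exp_gap_prob_unequal) (use assms(2) in \<open>simp_all add: mult_ac\<close>)
  also have "(\<Sum>k\<in>{k \<in> {0..n}. real k = real n / 2}. ?F k) = (if even n
       then real (n choose (n div 2)) * (exp_conn_prob lam r (n div 2))\<^sup>2 / 2 ^ n *
         (1 - exp (- real n * lam * r / 2) * (1 + real n * lam * r / 2))
       else 0)"
  proof (cases "even n")
    case True
    then obtain m where m: "n = 2 * m" by (elim evenE)
    then have *: "{k \<in> {0..n}. real k = real n / 2} = {n div 2}" and h: "n - n div 2 = n div 2"
      by auto
    show ?thesis unfolding * using True exp_gap_prob_equal[OF True \<open>n \<ge> 1\<close>, of lam r]
      by (simp add: h power2_eq_square)
  next
    case False
    have "real k \<noteq> real n / 2" for k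
    proof
      assume "real k = real n / 2"
      then have "n = 2 * k" by linarith
      with False show False by simp
    qed
    then have *: "{k \<in> {0..n}. real k = real n / 2} = {}" by auto
    show ?thesis unfolding * using False by simp
  qed
  finally show ?thesis .
qed

end
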